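(* Let $A$ be an operator generating a strongly continuous semigroup $(e^{tA})_{t\ge 0}$ in a Hilbert space $H$, and let $B\in\mathcal{L}(H)$ be a bounded operator. Assume that $e^{TA}=0$ for some $T>0$. Then there exist positive numbers $\epsilon_0, M, C$ such that for any $\epsilon\in(0,\epsilon_0)$, $$\|e^{t(A+\epsilon B)}\|_{\mathcal{L}(H)}\le M\,\inf\left(1,\ \frac{e^{-(C\ln\epsilon^{-1})t}}{\epsilon}\right)\qquad\forall t\ge 0 .$$
   Context: $\mathcal{L}(H)$ is the space of bounded linear operators on $H$ with the operator norm. For $\epsilon>0$, $(e^{t(A+\epsilon B)})_{t\ge0}$ denotes the strongly continuous semigroup generated by $A+\epsilon B$ (with domain $D(A)$). $\inf(p,q)$ denotes the minimum of two real numbers. *)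

theory Defs
  imports "HOL-Analysis.Analysis"
begin

text \<open>
  Operator families are indexed by \<^typ>\<open>real\<close>; only the values at nonnegative times matter.
  Scalars are real. A complex Hilbert space is covered as well: it is a real Hilbert space under
  the real part of its inner product, with the same norm, operator norm, semigroups and generators.
\<close>

definition C0_semigroup :: "(real \<Rightarrow> 'a::real_normed_vector \<Rightarrow>\<^sub>L 'a) \<Rightarrow> bool" where
  "C0_semigroup S \<longleftrightarrow>
     S 0 = id_blinfun \<and>
     (\<forall>s\<ge>0. \<forall>t\<ge>0. S (s + t) = S s o\<^sub>L S t) \<and>
     (\<forall>x. ((\<lambda>t. blinfun_apply (S t) x) \<longlongrightarrow> x) (at_right 0))"

definition has_generator_value ::
    "(real \<Rightarrow> 'a::real_normed_vector \<Rightarrow>\<^sub>L 'a) \<Rightarrow> 'a \<Rightarrow> 'a \<Rightarrow> bool" where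
  "has_generator_value S x y \<longleftrightarrow>
     ((\<lambda>h. (1 / h) *\<^sub>R (blinfun_apply (S h) x - x)) \<longlongrightarrow> y) (at_right 0)"

text \<open>
  An unbounded operator is given by its domain \<open>D\<close> and a total function \<open>A\<close> whose values outside
  \<open>D\<close> are irrelevant. The domain has to be exactly that of the infinitesimal generator.
\<close>

definition generates_C0_semigroup ::
    "'a::real_normed_vector set \<Rightarrow> ('a \<Rightarrow> 'a) \<Rightarrow> (real \<Rightarrow> 'a \<Rightarrow>\<^sub>L 'a) \<Rightarrow> bool" where
  "generates_C0_semigroup D A S \<longleftrightarrow>
     C0_semigroup S \<and>
     D = {x. \<exists>y. has_generator_value S x y} \<and>
     (\<forall>x\<in>D. has_generator_value S x (A x))"

end

theory Submission
  imports Defs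
begin

text \<open>
  Write \<open>V\<close> for the semigroup generated by \<open>A + \<epsilon> B\<close>, let \<open>M \<ge> 1\<close> bound \<open>S\<close> and put \<open>q = 2 M\<^sup>2 (\<parallel>B\<parallel> + 1) T\<close>.
  For \<open>x\<close> in the common domain the curve \<open>s \<mapsto> S (t - s) (V s x)\<close> has right derivative
  \<open>\<epsilon> S (t - s) (B (V s x))\<close>, so \<open>\<parallel>V t - S t\<parallel> \<le> \<epsilon> M \<parallel>B\<parallel> t sup \<parallel>V\<parallel>\<close> on \<open>[0, T]\<close>. For small \<open>\<epsilon>\<close> this gives
  \<open>\<parallel>V\<parallel> \<le> 2 M\<close> on \<open>[0, T]\<close>, and then \<open>\<parallel>V T\<parallel> \<le> \<epsilon> q \<le> sqrt \<epsilon>\<close> because \<open>S T = 0\<close>. The semigroup law yields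
  \<open>\<parallel>V t\<parallel> \<le> 2 M (sqrt \<epsilon>)^n\<close> with \<open>n = \<lfloor>t / T\<rfloor>\<close>, which is the claim with \<open>C = 1 / (2 T)\<close>.
  Since \<open>S\<close> vanishes after time \<open>T\<close>, the Duhamel equation for \<open>V\<close> is, for small \<open>\<epsilon>\<close>, a contraction on
  bounded continuous curves over the whole half line, whence the existence of \<open>V\<close>.
\<close>

subsection \<open>Uniform boundedness and a mean value inequality\<close>

text \<open>Banach-Steinhaus by Baire: the closed sets \<open>E k\<close> cover the space, so one of
  them contains a ball \<open>cball x r\<close>. A vector \<open>z\<close> of norm \<open>r\<close>
  is the difference of the points \<open>x + z\<close> and \<open>x\<close> of that ball, which
  gives \<open>norm (F i z) \<le> 2 * real k\<close> for all \<open>i\<close> at once.\<close>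

lemma uniform_boundedness:
  fixes F :: "'i \<Rightarrow> 'a::banach \<Rightarrow>\<^sub>L 'b::real_normed_vector"
  assumes "\<And>x. bounded (range (\<lambda>i. F i x))"
  shows "bounded (range F)"
proof -
  define E where "E k = {x. \<forall>i. norm (F i x) \<le> real k}" for k :: nat
  have "E k = (\<Inter>i. {x. norm (F i x) \<le> real k})" for k
    by (auto simp: E_def)
  then have clo: "closed (E k)" for k
    by (auto intro!: closed_Collect_le continuous_intros)
  have "(\<Union>k. E k) = UNIV"
  proof -
    have "\<exists>k. x \<in> E k" for x
    proof -
      obtain b where "\<And>i. norm (F i x) \<le> b"
        using assms[of x] unfolding bounded_iff by auto
      moreover obtain k where "b \<le> real k"
        using real_arch_simple by blast
      ultimately show ?thesis
        unfolding E_def by (smt (verit) mem_Collect_eq)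
    qed
    then show ?thesis by auto
  qed
  moreover have "complete (UNIV :: 'a set)" by (rule complete_UNIV)
  then have mc: "Met_TC.mcomplete TYPE('a)"
    by (metis MCauchy_iff_Cauchy Met_TC.mcomplete_def UNIV_I complete_def limitin_iff_tendsto)
  ultimately have "\<not> (\<forall>k. interior (E k) = {})"
    using Met_TC.metric_Baire_category_alt[OF mc, of "range E"] clo by force
  then obtain k x r where r: "r > 0" "cball x r \<subseteq> E k"
    by (metis all_not_in_conv mem_interior_cball)
  have "norm (F i) \<le> 2 * real k / r" for i
  proof (rule norm_blinfun_bound)
    fix y
    show "norm (F i y) \<le> 2 * real k / r * norm y"
    proof (cases "y = 0")
      case False
      define z where "z = (r / norm y) *\<^sub>R y"
      have "x + z \<in> cball x r" "x \<in> cball x r"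
        using r False by (auto simp: z_def dist_norm)
      then have "norm (F i (x + z)) \<le> k" "norm (F i x) \<le> k"
        using r unfolding E_def by blast+
      moreover have "F i z = F i (x + z) - F i x"
        by (simp add: blinfun.add_right)
      ultimately have "norm (F i z) \<le> 2 * real k"
        by (smt (verit) norm_triangle_ineq4)
      moreover have "norm (F i z) = r / norm y * norm (F i y)"
        using r by (simp add: z_def blinfun.scaleR_right)
      ultimately show ?thesis
        using r False by (simp add: field_simps)
    qed auto
  qed (use r in auto)
  then show ?thesis
    unfolding bounded_iff by blast
qed

text \<open>Continuous induction: for \<open>c > K\<close> the set \<open>Z\<close> of times at
  which the bound with slope \<open>c\<close> holds is compact, and the slope condition at its
  maximum \<open>m\<close> would produce a later element if \<open>m < b\<close>. The strict
  inequality \<open>K < c\<close> leaves the room needed to work with limits of right difference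
  quotients, and \<open>c\<close> finally decreases to \<open>K\<close>.\<close>

lemma norm_diff_le_of_right_slope:
  fixes f :: "real \<Rightarrow> 'a::real_normed_vector"
  assumes "a \<le> b" and cont: "continuous_on {a..b} f"
    and slope: "\<And>s c. a \<le> s \<Longrightarrow> s < b \<Longrightarrow> K < c \<Longrightarrow>
      \<forall>\<^sub>F h in at_right 0. norm (f (s + h) - f s) \<le> c * h"
  shows "norm (f b - f a) \<le> K * (b - a)"
proof -
  have *: "norm (f b - f a) \<le> c * (b - a)" if c: "K < c" for c
  proof -
    define Z where "Z = {a..b} \<inter> (\<lambda>s. c * (s - a) - norm (f s - f a)) -` {0..}"
    have "closed Z"
      unfolding Z_def by (intro continuous_closed_preimage continuous_intros cont)
    moreover have "bounded Z"
      by (rule bounded_subset[of "{a..b}"]) (auto simp: Z_def)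
    ultimately have "compact Z"
      using compact_eq_bounded_closed by blast
    moreover have "a \<in> Z"
      using \<open>a \<le> b\<close> by (auto simp: Z_def)
    ultimately obtain m where m: "m \<in> Z" "\<And>s. s \<in> Z \<Longrightarrow> s \<le> m"
      using compact_attains_sup by (metis empty_iff)
    have "m = b"
    proof (rule ccontr)
      assume "m \<noteq> b"
      with m have mb: "a \<le> m" "m < b" by (auto simp: Z_def)
      have "\<forall>\<^sub>F h in at_right 0. 0 < h \<and> h < b - m \<and> norm (f (m + h) - f m) \<le> c * h"
        using slope[OF mb c] eventually_at_right_real[of 0 "b - m"] mb
        by (auto elim: eventually_elim2)
      then obtain h where h: "0 < h" "h < b - m" "norm (f (m + h) - f m) \<le> c * h"
        using eventually_happens trivial_limit_at_right_real by blast
      have "norm (f (m + h) - f a) \<le> norm (f (m + h) - f m) + norm (f m - f a)"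
        using norm_triangle_ineq[of "f (m + h) - f m" "f m - f a"] by simp
      then have "m + h \<in> Z"
        using h m(1) by (auto simp: Z_def algebra_simps)
      then show False
        using m(2)[of "m + h"] h by auto
    qed
    then show ?thesis using m(1) by (auto simp: Z_def)
  qed
  show ?thesis
  proof (cases "a = b")
    case False
    with \<open>a \<le> b\<close> have ab: "a < b" by simp
    show ?thesis
    proof (rule field_le_epsilon)
      fix e :: real assume "e > 0"
      have "norm (f b - f a) \<le> (K + e / (b - a)) * (b - a)"
        using \<open>e > 0\<close> ab by (intro *) simp
      also have "\<dots> = K * (b - a) + e"
        using ab by (simp add: distrib_right)
      finally show "norm (f b - f a) \<le> K * (b - a) + e" .
    qed
  qed auto
qed

subsection \<open>Strongly continuous semigroups\<close>

lemma C0_semigroupD: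
  assumes "C0_semigroup S"
  shows C0_semigroup_0: "S 0 = id_blinfun"
    and C0_semigroup_add: "0 \<le> s \<Longrightarrow> 0 \<le> t \<Longrightarrow> S (s + t) = S s o\<^sub>L S t"
    and C0_semigroup_tendsto: "((\<lambda>t. S t x) \<longlongrightarrow> x) (at_right 0)"
  using assms by (auto simp: C0_semigroup_def)

text \<open>If no interval to the right of 0 carried a bound, there would be times
  \<open>h n\<close> tending to 0 with unbounded \<open>norm (S (h n))\<close>, although every orbit
  \<open>S (h n) x\<close> converges; this contradicts uniform boundedness. A bound on one short
  interval then spreads by the semigroup law.\<close>

lemma C0_semigroup_locally_bounded:
  fixes S :: "real \<Rightarrow> 'a::banach \<Rightarrow>\<^sub>L 'a"
  assumes S: "C0_semigroup S"
  obtains N where "N \<ge> 1" "\<And>t. 0 \<le> t \<Longrightarrow> t \<le> K \<Longrightarrow> norm (S t) \<le> N"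
proof -
  have "\<exists>n. \<forall>t. 0 \<le> t \<and> t \<le> 1 / real (Suc n) \<longrightarrow> norm (S t) \<le> real (Suc n)"
  proof (rule ccontr)
    assume "\<not> ?thesis"
    then obtain h where h: "\<And>n. 0 \<le> h n" "\<And>n. h n \<le> 1 / real (Suc n)"
        "\<And>n. norm (S (h n)) > real (Suc n)"
      by (metis linorder_not_le)
    \<comment> \<open>Strong continuity is a limit along positive times, so \<open>h\<close> must
      avoid 0. There the operator is the identity, whose norm is at most 1.\<close>
    have "h n \<noteq> 0" for n
    proof
      assume "h n = 0"
      then have "norm (S (h n)) \<le> 1"
        using C0_semigroup_0[OF S] norm_blinfun_id_le by metis
      with h(3)[of n] show False by simp
    qed
    then have pos: "h n > 0" for n
      using h(1) by (metis less_eq_real_def)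
    have "h \<longlonglongrightarrow> 0"
      by (rule tendsto_sandwich[OF _ _ tendsto_const LIMSEQ_inverse_real_of_nat])
         (use h in \<open>auto simp: inverse_eq_divide\<close>)
    with pos have h0: "filterlim h (at_right 0) sequentially"
      by (simp add: filterlim_at less_imp_neq[symmetric])
    have "bounded (range (\<lambda>n. S (h n) x))" for x
      by (rule convergent_imp_bounded)
         (rule filterlim_compose[OF C0_semigroup_tendsto[OF S] h0])
    then have "bounded (range (\<lambda>n. S (h n)))"
      by (rule uniform_boundedness)
    then obtain b where b: "\<And>n. norm (S (h n)) \<le> b"
      unfolding bounded_iff by auto
    obtain n where "b < real (Suc n)"
      using reals_Archimedean2 by (metis less_trans lessI of_nat_less_iff)
    with b[of n] h(3)[of n] show False by linarith
  qed
  then obtain n where n: "\<And>t. 0 \<le> t \<Longrightarrow> t \<le> 1 / real (Suc n) \<Longrightarrow> norm (S t) \<le> real (Suc n)"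
    by blast
  define d where "d = 1 / real (Suc n)"
  define N where "N = real (Suc n)"
  have d: "d > 0" and N: "N \<ge> 1" and dN: "\<And>t. 0 \<le> t \<Longrightarrow> t \<le> d \<Longrightarrow> norm (S t) \<le> N"
    using n by (auto simp: d_def N_def)
  have *: "norm (S t) \<le> N ^ Suc m" if "0 \<le> t" "t \<le> real m * d" for t m
    using that
  proof (induction m arbitrary: t)
    case 0
    then show ?case using dN[of 0] d by auto
  next
    case (Suc m)
    show ?case
    proof (cases "t \<le> d")
      case True
      then have "norm (S t) \<le> N" using dN Suc by auto
      also have "N ^ 1 \<le> N ^ Suc (Suc m)"
        using N by (intro power_increasing) auto
      then have "N \<le> N ^ Suc (Suc m)" by simp
      finally show ?thesis .
    next
      case False
      have "S t = S d o\<^sub>L S (t - d)"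
        using C0_semigroup_add[OF S, of d "t - d"] False d by simp
      also have "norm \<dots> \<le> norm (S d) * norm (S (t - d))"
        by (rule norm_blinfun_compose)
      also have "\<dots> \<le> N * N ^ Suc m"
        using Suc.prems False dN d N
        by (intro mult_mono Suc.IH) (auto simp: algebra_simps)
      finally show ?thesis by simp
    qed
  qed
  obtain m where "K / d \<le> real m"
    using real_arch_simple by blast
  then have "K \<le> real m * d" using d by (simp add: field_simps)
  then show ?thesis
    using * N by (intro that[of "N ^ Suc m"] one_le_power) (auto intro: order.trans)
qed

text \<open>Factoring out the operator at the smaller time leaves an increment starting at 0. With
  the absolute value both orders of \<open>s\<close> and \<open>t\<close> are covered, so that right
  continuity at 0 yields two-sided continuity elsewhere.\<close>

lemma C0_semigroup_dist:
  fixes S :: "real \<Rightarrow> 'a::banach \<Rightarrow>\<^sub>L 'a"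
  assumes S: "C0_semigroup S" and "0 \<le> s" "0 \<le> t"
    and N: "norm (S s) \<le> N" "norm (S t) \<le> N"
  shows "norm (S t x - S s x) \<le> N * norm (S \<bar>t - s\<bar> x - x)"
proof -
  have *: "norm (S t x - S s x) \<le> N * norm (S (t - s) x - x)" 
    if "0 \<le> s" "s \<le> t" "norm (S s) \<le> N" for s t
  proof -
    have "S t = S s o\<^sub>L S (t - s)"
      using C0_semigroup_add[OF S, of s "t - s"] that by simp
    then have "S t x - S s x = S s (S (t - s) x - x)"
      by (simp add: blinfun.diff_right)
    also have "norm \<dots> \<le> norm (S s) * norm (S (t - s) x - x)"
      by (rule norm_blinfun)
    also have "\<dots> \<le> N * norm (S (t - s) x - x)"
      using that by (intro mult_right_mono) auto
    finally show ?thesis .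
  qed
  show ?thesis
    using *[of s t] *[of t s] assms by (cases "s \<le> t") (auto simp: norm_minus_commute)
qed

text \<open>The semigroup is continuous only strongly, so time and argument are varied separately:
  the change of \<open>g\<close> is controlled by a local bound \<open>N\<close>, the change of
  \<open>u\<close> by \<open>C0_semigroup_dist\<close> at the fixed vector \<open>g z\<close>. The
  general parameter space serves both curves such as \<open>S (t - s) (V s x)\<close> and integrands
  of two real variables.\<close>

lemma C0_semigroup_continuous_apply:
  fixes S :: "real \<Rightarrow> 'a::banach \<Rightarrow>\<^sub>L 'a" and u :: "'b::metric_space \<Rightarrow> real"
  assumes S: "C0_semigroup S" and u: "continuous_on X u" "\<And>z. z \<in> X \<Longrightarrow> 0 \<le> u z"
    and g: "continuous_on X g"
  shows "continuous_on X (\<lambda>z. S (u z) (g z))"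
proof (clarsimp simp: continuous_on_def)
  fix z assume z: "z \<in> X"
  obtain N where N: "N \<ge> 1" "\<And>t. 0 \<le> t \<Longrightarrow> t \<le> u z + 1 \<Longrightarrow> norm (S t) \<le> N"
    using C0_semigroup_locally_bounded[OF S] by blast
  have uz: "(u \<longlongrightarrow> u z) (at z within X)" and gz: "(g \<longlongrightarrow> g z) (at z within X)"
    using u g z by (auto simp: continuous_on_def)
  have "((\<lambda>t. S t (g z)) \<longlongrightarrow> g z) (at 0 within {0..})"
  proof -
    have "((\<lambda>t. S t (g z)) \<longlongrightarrow> S 0 (g z)) (at_right 0)"
      using C0_semigroup_tendsto[OF S] C0_semigroup_0[OF S] by simp
    then show ?thesis
      using C0_semigroup_0[OF S] by (simp add: at_within_Ici_at_right)
  qed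
  \<comment> \<open>The increment \<open>\<bar>u w - u z\<bar>\<close> may equal 0 for
    \<open>w\<close> near \<open>z\<close>, so the limit is needed along a filter that does not
    exclude the point 0.\<close>
  then have c0: "((\<lambda>t. S t (g z)) \<longlongrightarrow> g z) (inf (nhds 0) (principal {0..}))"
    using C0_semigroup_0[OF S]
    by (auto simp: tendsto_def eventually_at_filter eventually_inf_principal elim!: eventually_mono)
  have "filterlim (\<lambda>w. \<bar>u w - u z\<bar>) (inf (nhds 0) (principal {0..})) (at z within X)"
    using tendsto_rabs[OF LIM_zero[OF uz]] by (auto simp: filterlim_inf filterlim_principal)
  from filterlim_compose[OF c0 this]
  have lim: "((\<lambda>w. S \<bar>u w - u z\<bar> (g z)) \<longlongrightarrow> g z) (at z within X)" .
  have "((\<lambda>w. S (u w) (g w) - S (u z) (g z)) \<longlongrightarrow> 0) (at z within X)"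
  proof (rule Lim_null_comparison)
    have "\<forall>\<^sub>F w in at z within X. u w < u z + 1 \<and> w \<in> X"
      using order_tendstoD(2)[OF uz, of "u z + 1"]
      by (auto simp: eventually_conj_iff eventually_at_topological)
    then show "\<forall>\<^sub>F w in at z within X. norm (S (u w) (g w) - S (u z) (g z)) 
      \<le> N * norm (g w - g z) + N * norm (S \<bar>u w - u z\<bar> (g z) - g z)"
    proof eventually_elim
      case (elim w)
      have Nw: "norm (S (u w)) \<le> N" "norm (S (u z)) \<le> N"
        using elim N(2) u(2) z by auto
      have "S (u w) (g w) - S (u z) (g z) = S (u w) (g w - g z) + (S (u w) (g z) - S (u z) (g z))"
        by (simp add: blinfun.diff_right)
      also have "norm \<dots> \<le> norm (S (u w) (g w - g z)) + norm (S (u w) (g z) - S (u z) (g z))"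
        by (rule norm_triangle_ineq)
      also have "norm (S (u w) (g w - g z)) \<le> N * norm (g w - g z)"
        using norm_blinfun[of "S (u w)" "g w - g z"] mult_right_mono[OF Nw(1), of "norm (g w - g z)"]
        by simp
      also have "norm (S (u w) (g z) - S (u z) (g z)) \<le> N * norm (S \<bar>u w - u z\<bar> (g z) - g z)"
        using elim u(2) z Nw by (intro C0_semigroup_dist S) auto
      finally show ?case by simp
    qed
    show "((\<lambda>w. N * norm (g w - g z) + N * norm (S \<bar>u w - u z\<bar> (g z) - g z)) \<longlongrightarrow> 0) (at z within X)"
      using tendsto_add[OF tendsto_mult[OF tendsto_const tendsto_norm[OF LIM_zero[OF gz]]]
          tendsto_mult[OF tendsto_const tendsto_norm[OF LIM_zero[OF lim]]]]
      by simp
  qed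
  then show "((\<lambda>w. S (u w) (g w)) \<longlongrightarrow> S (u z) (g z)) (at z within X)"
    by (rule LIM_zero_cancel)
qed

lemma C0_semigroup_continuous:
  fixes S :: "real \<Rightarrow> 'a::banach \<Rightarrow>\<^sub>L 'a"
  assumes "C0_semigroup S"
  shows "continuous_on {0..} (\<lambda>t. S t x)"
  by (intro C0_semigroup_continuous_apply[OF assms] continuous_intros) auto

section \<open>Integrals of orbits and the domain of the generator\<close>

lemma right_slope_integral:
  fixes g :: "real \<Rightarrow> 'a::banach"
  assumes g: "continuous_on {0..} g" and "0 \<le> t"
  shows "((\<lambda>h. (1 / h) *\<^sub>R (integral {0..t + h} g - integral {0..t} g)) \<longlongrightarrow> g t) (at_right 0)"
proof (rule tendstoI)
  fix e :: real assume "e > 0"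
  have "(g \<longlongrightarrow> g t) (at_right t)"
    using g \<open>0 \<le> t\<close> by (auto simp: continuous_on_def intro: tendsto_within_subset)
  then have "\<forall>\<^sub>F s in at_right t. dist (g s) (g t) < e / 2"
    using \<open>e > 0\<close> by (intro tendstoD) auto
  then obtain b where b: "b > t" "\<And>s. t < s \<Longrightarrow> s < b \<Longrightarrow> dist (g s) (g t) < e / 2"
    unfolding eventually_at_right_field by blast
  define d where "d = b - t"
  have d: "d > 0" "\<And>s. t < s \<Longrightarrow> s < t + d \<Longrightarrow> dist (g s) (g t) < e / 2"
    using b by (auto simp: d_def)
  have "\<forall>\<^sub>F h in at_right 0. 0 < h \<and> h < d"
    using eventually_at_right_real[OF d(1)] by (auto elim!: eventually_mono)
  then show "\<forall>\<^sub>F h in at_right 0.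
      dist ((1 / h) *\<^sub>R (integral {0..t + h} g - integral {0..t} g)) (g t) < e"
  proof eventually_elim
    case (elim h)
    have int: "g integrable_on {a..b}" if "0 \<le> a" for a b
      using that by (intro integrable_continuous_real continuous_on_subset[OF g]) auto
    have "integral {0..t + h} g - integral {0..t} g = integral {t..t + h} g"
      using Henstock_Kurzweil_Integration.integral_combine[of 0 t "t + h" g] \<open>0 \<le> t\<close> elim int by (simp add: algebra_simps)
    moreover have "((\<lambda>s. g s - g t) has_integral (integral {t..t + h} g - h *\<^sub>R g t)) (cbox t (t + h))"
      using has_integral_diff[OF integrable_integral[OF int[of t "t + h"]] 
          has_integral_const_real[of "g t" t "t + h"]] \<open>0 \<le> t\<close> elim
      by simp
    then have "norm (integral {t..t + h} g - h *\<^sub>R g t) \<le> e / 2 * measure lborel (cbox t (t + h))"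
    proof (rule has_integral_bound[rotated])
      fix s assume "s \<in> cbox t (t + h)"
      then show "norm (g s - g t) \<le> e / 2"
        using d(2)[of s] elim \<open>e > 0\<close> by (cases "s = t") (auto simp: dist_norm)
    qed (use \<open>e > 0\<close> in auto)
    then have "norm (integral {t..t + h} g - h *\<^sub>R g t) \<le> e / 2 * h"
      using elim by simp
    moreover have "norm ((1 / h) *\<^sub>R I - g t) = norm (I - h *\<^sub>R g t) / h" for I
    proof -
      have "(1 / h) *\<^sub>R I - g t = (1 / h) *\<^sub>R (I - h *\<^sub>R g t)"
        using elim by (simp add: algebra_simps)
      then show ?thesis using elim by simp
    qed
    ultimately have "dist ((1 / h) *\<^sub>R (integral {0..t + h} g - integral {0..t} g)) (g t) \<le> e / 2"
      using elim by (simp add: dist_norm pos_divide_le_eq)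
    then show ?case using \<open>e > 0\<close> by simp
  qed
qed

lemma integral_shift_real:
  fixes g :: "real \<Rightarrow> 'a::real_normed_vector"
  shows "integral {a..b} (\<lambda>s. g (s + c)) = integral {a + c..b + c} g"
proof -
  have "((\<lambda>s. g (1 *\<^sub>R s + c)) has_integral (I /\<^sub>R 1 ^ DIM(real))) 
      (cbox ((a + c - c) /\<^sub>R 1) ((b + c - c) /\<^sub>R 1)) \<longleftrightarrow> (g has_integral I) (cbox (a + c) (b + c))" for I
    by (rule has_integral_affinity_iff) simp
  then have "((\<lambda>s. g (s + c)) has_integral I) {a..b} \<longleftrightarrow> (g has_integral I) {a + c..b + c}" for I
    by simp
  then show ?thesis
    by (simp add: integral_def integrable_on_def)
qed

text \<open>Applying \<open>S h\<close> moves the interval of integration from \<open>{0..t}\<close>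
  to \<open>{h..t + h}\<close>. The difference from the original integral is therefore an integral
  over \<open>{t..t + h}\<close> minus one over \<open>{0..h}\<close>, and each has an obvious slope
  as \<open>h\<close> tends to 0.\<close>

lemma generator_value_of_integral:
  fixes S :: "real \<Rightarrow> 'a::banach \<Rightarrow>\<^sub>L 'a"
  assumes S: "C0_semigroup S" and "0 \<le> t"
  shows "has_generator_value S (integral {0..t} (\<lambda>s. S s x)) (S t x - x)"
proof -
  let ?g = "\<lambda>s. S s x"
  define I where "I r = integral {0..r} ?g" for r
  have g: "continuous_on {0..} ?g" by (rule C0_semigroup_continuous[OF S])
  have int: "?g integrable_on {a..b}" if "0 \<le> a" for a b
    using that by (intro integrable_continuous_real continuous_on_subset[OF g]) auto
  have eq: "S h (I t) - I t = (I (t + h) - I t) - (I (0 + h) - I 0)" if "0 < h" for h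
  proof -
    have "S h (I t) = integral {0..t} (\<lambda>s. S h (S s x))"
      unfolding I_def by (rule integral_blinfun_apply[symmetric]) (rule int, simp)
    also have "\<dots> = integral {0..t} (\<lambda>s. S (s + h) x)"
      using C0_semigroup_add[OF S, of h] that
      by (intro integral_cong) (auto simp: add.commute)
    also have "\<dots> = integral {0 + h..t + h} ?g"
      by (rule integral_shift_real)
    also have "\<dots> = I (t + h) - I h"
      using Henstock_Kurzweil_Integration.integral_combine[of 0 h "t + h" ?g] int that \<open>0 \<le> t\<close>
      by (simp add: I_def algebra_simps)
    finally show ?thesis by (simp add: I_def)
  qed
  have "((\<lambda>h. (1 / h) *\<^sub>R (I (t + h) - I t) - (1 / h) *\<^sub>R (I (0 + h) - I 0)) \<longlongrightarrow> S t x - S 0 x) (at_right 0)"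
    unfolding I_def by (intro tendsto_diff right_slope_integral g \<open>0 \<le> t\<close>) simp
  moreover have "\<forall>\<^sub>F h in at_right 0. (1 / h) *\<^sub>R (I (t + h) - I t) - (1 / h) *\<^sub>R (I (0 + h) - I 0)
      = (1 / h) *\<^sub>R (S h (I t) - I t)"
    by (rule eventually_at_rightI[of 0 1]) (simp_all add: eq flip: scaleR_diff_right)
  ultimately have "((\<lambda>h. (1 / h) *\<^sub>R (S h (I t) - I t)) \<longlongrightarrow> S t x - S 0 x) (at_right 0)"
    by (rule Lim_transform_eventually)
  then show ?thesis
    by (simp add: has_generator_value_def I_def C0_semigroup_0[OF S])
qed

lemma generator_value_scaleR:
  assumes "has_generator_value S x y"
  shows "has_generator_value S (c *\<^sub>R x) (c *\<^sub>R y)"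
  using tendsto_scaleR[OF tendsto_const[of c] assms[unfolded has_generator_value_def]]
  by (simp add: has_generator_value_def blinfun.scaleR_right algebra_simps)

text \<open>The averages of the orbit of \<open>x\<close> over \<open>{0..h}\<close> lie in the
  domain by \<open>generator_value_of_integral\<close> and tend to \<open>x\<close> as
  \<open>h\<close> tends to 0.\<close>

lemma generator_domain_dense:
  fixes S :: "real \<Rightarrow> 'a::banach \<Rightarrow>\<^sub>L 'a"
  assumes S: "C0_semigroup S"
  shows "closure {x. \<exists>y. has_generator_value S x y} = UNIV"
proof -
  have "x \<in> closure {x. \<exists>y. has_generator_value S x y}" for x
  proof (rule Lim_in_closed_set[OF closed_closure])
    let ?m = "\<lambda>h. (1 / h) *\<^sub>R (integral {0..0 + h} (\<lambda>s. S s x) - integral {0..0} (\<lambda>s. S s x))"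
    show "(?m \<longlongrightarrow> x) (at_right 0)"
      using right_slope_integral[OF C0_semigroup_continuous[OF S], of 0 x] C0_semigroup_0[OF S] by simp
    have "?m h \<in> {x. \<exists>y. has_generator_value S x y}" if "0 < h" for h
      using generator_value_scaleR[OF generator_value_of_integral[OF S, of h x]] that by auto
    then show "\<forall>\<^sub>F h in at_right 0. ?m h \<in> closure {x. \<exists>y. has_generator_value S x y}"
      using closure_subset by (intro eventually_at_rightI[of 0 1]) fastforce+
  qed simp
  then show ?thesis by auto
qed

lemma generator_value_invariant:
  assumes S: "C0_semigroup S" and "0 \<le> t" and x: "has_generator_value S x y"
  shows "has_generator_value S (S t x) (S t y)"
proof -
  have "((\<lambda>h. S t ((1 / h) *\<^sub>R (S h x - x))) \<longlongrightarrow> S t y) (at_right 0)"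
    using x unfolding has_generator_value_def
    by (rule blinfun.tendsto[OF tendsto_const])
  moreover have "\<forall>\<^sub>F h in at_right 0. S t ((1 / h) *\<^sub>R (S h x - x)) = (1 / h) *\<^sub>R (S h (S t x) - S t x)"
  proof (rule eventually_at_rightI[of 0 1])
    fix h :: real assume "h \<in> {0<..<1}"
    have "S h o\<^sub>L S t = S t o\<^sub>L S h"
      using C0_semigroup_add[OF S, of h t] C0_semigroup_add[OF S, of t h] \<open>h \<in> {0<..<1}\<close> \<open>0 \<le> t\<close>
      by (simp add: add.commute)
    from arg_cong[OF this, of "\<lambda>F. F x"]
    show "S t ((1 / h) *\<^sub>R (S h x - x)) = (1 / h) *\<^sub>R (S h (S t x) - S t x)"
      by (simp add: blinfun.scaleR_right blinfun.diff_right)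
  qed simp
  ultimately show ?thesis
    unfolding has_generator_value_def
    by (rule Lim_transform_eventually)
qed

text \<open>The curve \<open>f\<close> joins \<open>S t x\<close> to \<open>V t x\<close>. Its
  increment over \<open>{s..s + h}\<close> is \<open>S (t - (s + h))\<close> applied to
  \<open>V h y - S h y\<close> with \<open>y = V s x\<close>, so bounding the first operator by
  \<open>M\<close> leaves a limit that \<open>diff\<close> provides. Invariance keeps
  \<open>y\<close> in \<open>D\<close>, and density carries the estimate from \<open>D\<close> to
  all vectors.\<close>

lemma semigroup_difference_bound:
  fixes S V :: "real \<Rightarrow> 'a::banach \<Rightarrow>\<^sub>L 'a" and P :: "'a \<Rightarrow>\<^sub>L 'a"
  assumes S: "C0_semigroup S" and V: "C0_semigroup V" and "closure D = UNIV"
    and inv: "\<And>x s. x \<in> D \<Longrightarrow> 0 \<le> s \<Longrightarrow> V s x \<in> D"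
    and diff: "\<And>x. x \<in> D \<Longrightarrow> ((\<lambda>h. (1 / h) *\<^sub>R (V h x - S h x)) \<longlongrightarrow> P x) (at_right 0)"
    and M: "\<And>s. 0 \<le> s \<Longrightarrow> s \<le> t \<Longrightarrow> norm (S s) \<le> M"
    and N: "\<And>s. 0 \<le> s \<Longrightarrow> s \<le> t \<Longrightarrow> norm (V s) \<le> N"
    and "0 \<le> t"
  shows "norm (V t - S t) \<le> M * norm P * N * t"
proof -
  have M0: "0 \<le> M" and N0: "0 \<le> N"
    using M[of 0] N[of 0] \<open>0 \<le> t\<close> norm_ge_zero order.trans by blast+
  have on_D: "norm ((V t - S t) x) \<le> M * norm P * N * t * norm x" if x: "x \<in> D" for x
  proof -
    define f where "f s = S (t - s) (V s x)" for s
    let ?K = "M * norm P * N * norm x"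
    have "norm (f t - f 0) \<le> ?K * (t - 0)"
    proof (rule norm_diff_le_of_right_slope[OF \<open>0 \<le> t\<close>])
      show "continuous_on {0..t} f"
        unfolding f_def
        by (intro C0_semigroup_continuous_apply[OF S] C0_semigroup_continuous_apply[OF V] continuous_intros)
           auto
      fix s c assume s: "0 \<le> s" "s < t" and c: "?K < c"
      let ?y = "V s x"
      have "norm (P ?y) \<le> norm P * (N * norm x)"
        using norm_blinfun[of P ?y] norm_blinfun[of "V s" x] N[of s] s
        by (smt (verit) mult_left_mono mult_right_mono norm_ge_zero)
      then have "M * norm (P ?y) \<le> ?K"
        using mult_left_mono[OF _ M0] by (metis mult.assoc)
      with c have "M * norm (P ?y) < c" by simp
      moreover have "((\<lambda>h. M * norm ((1 / h) *\<^sub>R (V h ?y - S h ?y))) \<longlongrightarrow> M * norm (P ?y)) (at_right 0)"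
        using s by (intro tendsto_intros diff inv x)
      ultimately have "\<forall>\<^sub>F h in at_right 0. M * norm ((1 / h) *\<^sub>R (V h ?y - S h ?y)) < c"
        using order_tendstoD(2) by blast
      moreover have "\<forall>\<^sub>F h in at_right 0. 0 < h \<and> h < t - s"
        using eventually_at_right_real[of 0 "t - s"] s by (auto elim!: eventually_mono)
      ultimately show "\<forall>\<^sub>F h in at_right 0. norm (f (s + h) - f s) \<le> c * h"
      proof eventually_elim
        case (elim h)
        have "M * norm (V h ?y - S h ?y) / h < c"
          using elim by (simp flip: scaleR_diff_right)
        then have le: "M * norm (V h ?y - S h ?y) \<le> c * h"
          using elim by (simp add: pos_divide_less_eq)
        have "V (s + h) = V h o\<^sub>L V s"
          using C0_semigroup_add[OF V, of h s] elim s by (simp add: add.commute)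
        moreover have "S (t - s) = S (t - (s + h)) o\<^sub>L S h"
          using C0_semigroup_add[OF S, of "t - (s + h)" h] elim by simp
        ultimately have "f (s + h) - f s = S (t - (s + h)) (V h ?y - S h ?y)"
          by (simp add: f_def blinfun.diff_right)
        also have "norm \<dots> \<le> M * norm (V h ?y - S h ?y)"
          using norm_blinfun[of "S (t - (s + h))" "V h ?y - S h ?y"] M[of "t - (s + h)"] elim s
          by (smt (verit) mult_right_mono norm_ge_zero)
        also note le
        finally show ?case .
      qed
    qed
    then show ?thesis
      by (simp add: f_def C0_semigroup_0[OF S] C0_semigroup_0[OF V] blinfun.diff_left mult_ac)
  qed
  let ?X = "{x. norm ((V t - S t) x) \<le> M * norm P * N * t * norm x}"
  have "closed ?X"
    by (intro closed_Collect_le continuous_intros)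
  moreover have "D \<subseteq> ?X" using on_D by auto
  ultimately have "?X = UNIV"
    using \<open>closure D = UNIV\<close> closure_minimal by blast
  then show ?thesis
    using M0 N0 \<open>0 \<le> t\<close> by (intro norm_blinfun_bound) auto
qed

subsection \<open>The Duhamel integral\<close>

definition convolution :: "(real \<Rightarrow> 'a::real_normed_vector \<Rightarrow>\<^sub>L 'a) \<Rightarrow> (real \<Rightarrow> 'a) \<Rightarrow> real \<Rightarrow> 'a" where
  "convolution S g t = integral {0..t} (\<lambda>s. S (t - s) (g s))"

lemma convolution_integrand_continuous:
  fixes S :: "real \<Rightarrow> 'a::banach \<Rightarrow>\<^sub>L 'a"
  assumes "C0_semigroup S" "continuous_on {0..} g"
  shows "continuous_on {0..t} (\<lambda>s. S (t - s) (g s))"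
  by (intro C0_semigroup_continuous_apply[OF assms(1)] continuous_intros continuous_on_subset[OF assms(2)])
     auto

lemma convolution_integrable:
  fixes S :: "real \<Rightarrow> 'a::banach \<Rightarrow>\<^sub>L 'a"
  assumes "C0_semigroup S" "continuous_on {0..} g" "0 \<le> a" "b \<le> t"
  shows "(\<lambda>s. S (t - s) (g s)) integrable_on {a..b}"
  using assms(3,4)
  by (intro integrable_continuous_real 
      continuous_on_subset[OF convolution_integrand_continuous[OF assms(1,2), of t]]) auto

lemma convolution_has_integral:
  fixes S :: "real \<Rightarrow> 'a::banach \<Rightarrow>\<^sub>L 'a"
  assumes "C0_semigroup S" "continuous_on {0..} g"
  shows "((\<lambda>s. S (t - s) (g s)) has_integral convolution S g t) {0..t}"
  using convolution_integrable[OF assms, of 0 t t]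
  by (auto simp: convolution_def integrable_integral)

text \<open>The fixed interval of integration makes continuity in \<open>t\<close> a matter of joint continuity.\<close>

lemma convolution_rescale:
  fixes S :: "real \<Rightarrow> 'a::banach \<Rightarrow>\<^sub>L 'a"
  assumes S: "C0_semigroup S" and g: "continuous_on {0..} g" and "0 \<le> t"
  shows "convolution S g t = t *\<^sub>R integral {0..1} (\<lambda>r. S (t - t * r) (g (t * r)))"
proof (cases "t = 0")
  case False
  with \<open>0 \<le> t\<close> have t: "t > 0" by simp
  have "((\<lambda>r. S (t - (t *\<^sub>R r + 0)) (g (t *\<^sub>R r + 0))) has_integral convolution S g t /\<^sub>R t ^ DIM(real))
      (cbox ((0 - 0) /\<^sub>R t) ((t - 0) /\<^sub>R t))"
    using convolution_has_integral[OF S g, of t] t by (intro has_integral_affinity') auto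
  then have "((\<lambda>r. S (t - t * r) (g (t * r))) has_integral convolution S g t /\<^sub>R t) {0..1}"
    using t by simp
  then show ?thesis
    using t by (simp add: integral_unique)
qed (simp add: convolution_def)

text \<open>Continuity is recorded before multiplication by \<open>t\<close>: the value of this
  integral at \<open>t = 0\<close> is \<open>g 0\<close>, which is the limit of
  \<open>convolution S g h\<close> divided by \<open>h\<close> in
  \<open>convolution_slope_0\<close>.\<close>

lemma rescaled_convolution_continuous:
  fixes S :: "real \<Rightarrow> 'a::banach \<Rightarrow>\<^sub>L 'a"
  assumes S: "C0_semigroup S" and g: "continuous_on {0..} g"
  shows "continuous_on {0..} (\<lambda>t. integral {0..1} (\<lambda>r. S (t - t * r) (g (t * r))))"
proof -
  have "continuous_on ({0..} \<times> cbox 0 1) (\<lambda>z. S (fst z - fst z * snd z) (g (fst z * snd z)))"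
  proof (rule C0_semigroup_continuous_apply[OF S])
    show "continuous_on ({0..} \<times> cbox 0 1) (\<lambda>z. g (fst z * snd z))"
      by (rule continuous_on_compose2[OF g]) (auto intro!: continuous_intros)
  qed (auto intro!: continuous_intros simp: mult_left_le)
  then have "continuous_on {0..} (\<lambda>t. integral (cbox 0 1) (\<lambda>r. S (t - t * r) (g (t * r))))"
    by (intro integral_continuous_on_param) (simp add: case_prod_unfold)
  then show ?thesis by simp
qed

lemma convolution_continuous:
  fixes S :: "real \<Rightarrow> 'a::banach \<Rightarrow>\<^sub>L 'a"
  assumes S: "C0_semigroup S" and g: "continuous_on {0..} g"
  shows "continuous_on {0..} (convolution S g)"
proof -
  have "continuous_on {0..} (\<lambda>t. t *\<^sub>R integral {0..1} (\<lambda>r. S (t - t * r) (g (t * r))))"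
    by (intro continuous_on_scaleR continuous_on_id rescaled_convolution_continuous S g)
  then show ?thesis
    by (rule continuous_on_eq) (simp add: convolution_rescale[OF S g])
qed

lemma convolution_slope_0:
  fixes S :: "real \<Rightarrow> 'a::banach \<Rightarrow>\<^sub>L 'a"
  assumes S: "C0_semigroup S" and g: "continuous_on {0..} g"
  shows "((\<lambda>h. (1 / h) *\<^sub>R convolution S g h) \<longlongrightarrow> g 0) (at_right 0)"
proof -
  let ?J = "\<lambda>t. integral {0..1} (\<lambda>r. S (t - t * r) (g (t * r)))"
  have "(?J \<longlongrightarrow> ?J 0) (at 0 within {0..})"
    using rescaled_convolution_continuous[OF S g] unfolding continuous_on_def
    by (rule bspec) simp
  then have "(?J \<longlongrightarrow> ?J 0) (at_right 0)"
    by (simp only: at_within_Ici_at_right)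
  then have "(?J \<longlongrightarrow> g 0) (at_right 0)"
    by (simp add: C0_semigroup_0[OF S])
  moreover have "\<forall>\<^sub>F h in at_right 0. ?J h = (1 / h) *\<^sub>R convolution S g h"
    by (rule eventually_at_rightI[of 0 1]) (auto simp: convolution_rescale[OF S g])
  ultimately show ?thesis
    by (rule Lim_transform_eventually)
qed

text \<open>Split the integral at \<open>s\<close>: on the first piece \<open>S t\<close> factors
  out, and the second piece is shifted to start at 0. This identity makes time shifts of mild
  solutions mild solutions again.\<close>

lemma convolution_add:
  fixes S :: "real \<Rightarrow> 'a::banach \<Rightarrow>\<^sub>L 'a"
  assumes S: "C0_semigroup S" and g: "continuous_on {0..} g" and s: "0 \<le> s" and t: "0 \<le> t"
  shows "convolution S g (s + t) = S t (convolution S g s) + convolution S (\<lambda>r. g (s + r)) t"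
proof -
  let ?f = "\<lambda>r. S (s + t - r) (g r)"
  have "convolution S g (s + t) = integral {0..s} ?f + integral {s..s + t} ?f"
    unfolding convolution_def using s t
    by (intro Henstock_Kurzweil_Integration.integral_combine[symmetric]
        convolution_integrable[OF S g]) auto
  also have "integral {0..s} ?f = integral {0..s} (\<lambda>r. S t (S (s - r) (g r)))"
  proof (rule integral_cong)
    fix r assume "r \<in> {0..s}"
    then have "S (t + (s - r)) = S t o\<^sub>L S (s - r)"
      using C0_semigroup_add[OF S, of t "s - r"] t by simp
    moreover have "s + t - r = t + (s - r)" by simp
    ultimately show "?f r = S t (S (s - r) (g r))"
      by (simp only: blinfun_apply_blinfun_compose)
  qed
  also have "\<dots> = S t (convolution S g s)"
    unfolding convolution_def
    by (intro integral_blinfun_apply convolution_integrable[OF S g]) auto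
  also have "integral {s..s + t} ?f = integral {0 + s..t + s} ?f"
    by (simp add: add.commute)
  also have "\<dots> = convolution S (\<lambda>r. g (s + r)) t"
    unfolding convolution_def
    by (subst integral_shift_real[symmetric]) (simp add: algebra_simps)
  finally show ?thesis .
qed

lemma convolution_linear:
  fixes S :: "real \<Rightarrow> 'a::banach \<Rightarrow>\<^sub>L 'a"
  assumes S: "C0_semigroup S" and f: "continuous_on {0..} f" and g: "continuous_on {0..} g"
  shows "convolution S (\<lambda>s. a *\<^sub>R f s + b *\<^sub>R g s) t = a *\<^sub>R convolution S f t + b *\<^sub>R convolution S g t"
proof -
  have "((\<lambda>s. a *\<^sub>R S (t - s) (f s) + b *\<^sub>R S (t - s) (g s)) has_integral
      a *\<^sub>R convolution S f t + b *\<^sub>R convolution S g t) {0..t}"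
    by (intro has_integral_add has_integral_cmul convolution_has_integral assms)
  then show ?thesis
    by (simp add: convolution_def blinfun.add_right blinfun.scaleR_right integral_unique)
qed

text \<open>The integrand vanishes for \<open>r \<le> t - T\<close>, so only the last stretch, of
  length at most \<open>T\<close>, contributes. The bound is hence uniform in \<open>t\<close>,
  which allows a fixed point argument on the whole half line.\<close>

lemma nilpotent_convolution_bound:
  fixes S :: "real \<Rightarrow> 'a::banach \<Rightarrow>\<^sub>L 'a"
  assumes S: "C0_semigroup S" and g: "continuous_on {0..} g"
    and "0 \<le> T" and nil: "\<And>t. T \<le> t \<Longrightarrow> S t = 0"
    and M: "\<And>t. 0 \<le> t \<Longrightarrow> norm (S t) \<le> M"
    and Q: "\<And>s. 0 \<le> s \<Longrightarrow> norm (g s) \<le> Q"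
    and "0 \<le> t"
  shows "norm (convolution S g t) \<le> M * Q * T"
proof -
  have M0: "0 \<le> M" and Q0: "0 \<le> Q"
    using M[of 0] Q[of 0] norm_ge_zero order.trans by blast+
  let ?f = "\<lambda>r. S (t - r) (g r)"
  define c where "c = max 0 (t - T)"
  have c: "0 \<le> c" "c \<le> t" "t - c \<le> T"
    using \<open>0 \<le> T\<close> \<open>0 \<le> t\<close> by (auto simp: c_def)
  have "convolution S g t = integral {0..c} ?f + integral {c..t} ?f"
    unfolding convolution_def using c
    by (intro Henstock_Kurzweil_Integration.integral_combine[symmetric]
        convolution_integrable[OF S g]) auto
  also have "integral {0..c} ?f = 0"
  proof (cases "t \<le> T")
    case False
    then have "integral {0..c} ?f = integral {0..c} (\<lambda>_. 0)"
      using nil by (intro integral_cong) (auto simp: c_def)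
    then show ?thesis by simp
  qed (simp add: c_def)
  finally have "norm (convolution S g t) = norm (integral {c..t} ?f)" by simp
  also have "\<dots> \<le> M * Q * (t - c)"
  proof (rule integral_bound)
    show "continuous_on {c..t} ?f"
      using c by (intro continuous_on_subset[OF convolution_integrand_continuous[OF S g]]) auto
    fix r assume r: "r \<in> {c..t}"
    have "norm (?f r) \<le> norm (S (t - r)) * norm (g r)"
      by (rule norm_blinfun)
    also have "\<dots> \<le> M * Q"
      using r c M0 by (intro mult_mono M Q) auto
    finally show "norm (?f r) \<le> M * Q" .
  qed (use c in auto)
  also have "\<dots> \<le> M * Q * T"
    using c M0 Q0 by (intro mult_left_mono) auto
  finally show ?thesis .
qed

subsection \<open>Bounded perturbations of nilpotent semigroups\<close>

text \<open>The integral form makes sense for every initial vector, inside or outside the domain of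
  the generator. Boundedness is included because existence and uniqueness are both argued in the
  supremum norm.\<close>

definition mild_solution ::
    "(real \<Rightarrow> 'a::real_normed_vector \<Rightarrow>\<^sub>L 'a) \<Rightarrow> ('a \<Rightarrow>\<^sub>L 'a) \<Rightarrow> 'a \<Rightarrow> (real \<Rightarrow> 'a) \<Rightarrow> bool" where
  "mild_solution S P x u \<longleftrightarrow> continuous_on {0..} u \<and> bounded (u ` {0..}) \<and>
     (\<forall>t\<ge>0. u t = S t x + convolution S (\<lambda>s. P (u s)) t)"

text \<open>Here \<open>P\<close> stands for \<epsilon> times \<open>B\<close>. The smallness
  assumption gives the Duhamel term the contraction factor \<open>1 / 2\<close>.\<close>

locale small_perturbation =
  fixes S :: "real \<Rightarrow> 'a::banach \<Rightarrow>\<^sub>L 'a" and P :: "'a \<Rightarrow>\<^sub>L 'a" and T M :: real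
  assumes S: "C0_semigroup S" and T: "0 \<le> T" and nil: "T \<le> t \<Longrightarrow> S t = 0"
    and M: "0 \<le> t \<Longrightarrow> norm (S t) \<le> M" and small: "M * norm P * T \<le> 1 / 2"
begin

lemma continuous_perturbation: "continuous_on X g \<Longrightarrow> continuous_on X (\<lambda>s. P (g s))"
  by (intro continuous_intros)

lemma convolution_perturbation_bound:
  assumes g: "continuous_on {0..} g" and Q: "\<And>s. 0 \<le> s \<Longrightarrow> norm (g s) \<le> Q" and "0 \<le> t"
  shows "norm (convolution S (\<lambda>s. P (g s)) t) \<le> Q / 2"
proof -
  have Q0: "0 \<le> Q" using Q[of 0] norm_ge_zero order.trans by blast
  have "norm (P (g s)) \<le> norm P * Q" if "0 \<le> s" for s
    using norm_blinfun[of P "g s"] mult_left_mono[OF Q[OF that] norm_ge_zero[of P]] by linarith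
  then have "norm (convolution S (\<lambda>s. P (g s)) t) \<le> M * (norm P * Q) * T"
    by (intro nilpotent_convolution_bound S continuous_perturbation g T nil M \<open>0 \<le> t\<close>)
  also have "\<dots> = (M * norm P * T) * Q" by simp
  also have "\<dots> \<le> 1 / 2 * Q"
    using small Q0 by (rule mult_right_mono)
  finally show ?thesis by simp
qed

lemma mild_solution_exists: "\<exists>u. mild_solution S P x u"
proof -
  let ?c = "\<lambda>u :: real \<Rightarrow> 'a. convolution S (\<lambda>s. P (u s))"
  \<comment> \<open>Bounded continuous functions are taken on the whole real line, so the Duhamel
    map is frozen at its value at 0 for negative times.\<close>
  define F where "F u t = S (max 0 t) x + ?c u (max 0 t)" for u :: "real \<Rightarrow> 'a" and t
  have cont: "continuous_on {0..} (\<lambda>s. P (apply_bcontfun u s))" for u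
    by (intro continuous_perturbation) auto
  have F: "F u \<in> bcontfun" for u :: "real \<Rightarrow>\<^sub>C 'a"
  proof -
    obtain Q where Q: "\<And>s. norm (u s) \<le> Q"
      using bounded_apply_bcontfun[of u] unfolding bounded_iff by auto
    have "continuous_on UNIV (F u)"
      unfolding F_def
    proof (rule continuous_on_add)
      have max: "continuous_on UNIV (\<lambda>t. max 0 t :: real)"
        by (intro continuous_intros)
      show "continuous_on UNIV (\<lambda>t. S (max 0 t) x)"
        by (rule continuous_on_compose2[OF C0_semigroup_continuous[OF S] max]) auto
      show "continuous_on UNIV (\<lambda>t. ?c u (max 0 t))"
        by (rule continuous_on_compose2[OF convolution_continuous[OF S cont] max]) auto
    qed
    moreover have "norm (F u t) \<le> M * norm x + Q / 2" for t
    proof -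
      have "norm (F u t) \<le> norm (S (max 0 t) x) + norm (?c u (max 0 t))"
        unfolding F_def by (rule norm_triangle_ineq)
      also have "norm (S (max 0 t) x) \<le> M * norm x"
        using norm_blinfun[of "S (max 0 t)" x] mult_right_mono[OF M[of "max 0 t"] norm_ge_zero[of x]]
        by simp
      also have "norm (?c u (max 0 t)) \<le> Q / 2"
        by (rule convolution_perturbation_bound) (auto simp: Q)
      finally show ?thesis by simp
    qed
    then have "bounded (range (F u))"
      unfolding bounded_iff by auto
    ultimately show ?thesis by (simp add: bcontfun_def)
  qed
  have "dist (Bcontfun (F u)) (Bcontfun (F v)) \<le> 1 / 2 * dist u v" for u v :: "real \<Rightarrow>\<^sub>C 'a"
  proof (rule dist_bound)
    fix t
    \<comment> \<open>The term with \<open>x\<close> cancels and the Duhamel term is linear in the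
      curve.\<close>
    have "F u t - F v t = ?c (\<lambda>s. u s - v s) (max 0 t)"
      using convolution_linear[OF S cont[of u] cont[of v], of 1 "-1" "max 0 t"]
      by (simp add: F_def blinfun.diff_right)
    also have "norm \<dots> \<le> dist u v / 2"
      using dist_bounded[of u _ v]
      by (intro convolution_perturbation_bound continuous_intros) (auto simp: dist_norm)
    finally show "dist (Bcontfun (F u) t) (Bcontfun (F v) t) \<le> 1 / 2 * dist u v"
      by (simp add: Bcontfun_inverse[OF F] dist_norm)
  qed
  then have "\<exists>!u. Bcontfun (F (apply_bcontfun u)) = u"
    by (intro banach_fix_type[of "1 / 2"]) auto
  then obtain u where u: "F (apply_bcontfun u) = u"
    using F Bcontfun_inverse by metis
  have "u t = S t x + ?c u t" if "0 \<le> t" for t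
  proof -
    have "u t = F u t" by (simp only: u)
    also have "\<dots> = S t x + ?c u t" using that by (simp add: F_def)
    finally show ?thesis .
  qed
  moreover have "bounded (apply_bcontfun u ` {0..})"
    by (rule bounded_subset[OF bounded_apply_bcontfun]) auto
  ultimately show ?thesis
    by (intro exI[of _ "apply_bcontfun u"]) (auto simp: mild_solution_def)
qed

text \<open>The supremum \<open>?Q\<close> is finite by definition of a mild solution and satisfies
  \<open>?Q \<le> M * norm x + ?Q / 2\<close>; the last term is absorbed on the left.\<close>

lemma mild_solution_bound:
  assumes u: "mild_solution S P x u" and "0 \<le> t"
  shows "norm (u t) \<le> 2 * M * norm x"
proof -
  let ?Q = "SUP s\<in>{0..}. norm (u s)"
  have "bounded (u ` {0..})"
    using u unfolding mild_solution_def by blast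
  then have bdd: "bdd_above ((\<lambda>s. norm (u s)) ` {0..})"
    by (auto simp: bounded_iff bdd_above_def)
  have Q: "norm (u s) \<le> ?Q" if "0 \<le> s" for s
    using that by (intro cSUP_upper bdd) auto
  have "?Q \<le> M * norm x + ?Q / 2"
  proof (rule cSUP_least)
    fix s :: real assume "s \<in> {0..}"
    then have s: "0 \<le> s" by simp
    have "norm (u s) \<le> norm (S s x) + norm (convolution S (\<lambda>s. P (u s)) s)"
      using u s norm_triangle_ineq by (simp add: mild_solution_def)
    also have "norm (S s x) \<le> M * norm x"
      using norm_blinfun[of "S s" x] mult_right_mono[OF M[OF s] norm_ge_zero[of x]] by simp
    also have "norm (convolution S (\<lambda>s. P (u s)) s) \<le> ?Q / 2"
      using u Q s by (intro convolution_perturbation_bound) (auto simp: mild_solution_def)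
    finally show "norm (u s) \<le> M * norm x + ?Q / 2" by simp
  qed auto
  with Q[OF \<open>0 \<le> t\<close>] show ?thesis by simp
qed

lemma mild_solution_linear:
  assumes u: "mild_solution S P x u" and v: "mild_solution S P y v"
  shows "mild_solution S P (a *\<^sub>R x + b *\<^sub>R y) (\<lambda>t. a *\<^sub>R u t + b *\<^sub>R v t)"
proof -
  have cu: "continuous_on {0..} u" and cv: "continuous_on {0..} v"
    using u v by (auto simp: mild_solution_def)
  have "bounded ((\<lambda>t. a *\<^sub>R u t + b *\<^sub>R v t) ` {0..})"
    using u v by (intro bounded_plus_comp bounded_scaleR_comp) (auto simp: mild_solution_def)
  moreover have "continuous_on {0..} (\<lambda>t. a *\<^sub>R u t + b *\<^sub>R v t)"
    by (intro continuous_intros cu cv)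
  moreover have "a *\<^sub>R u t + b *\<^sub>R v t = S t (a *\<^sub>R x + b *\<^sub>R y)
      + convolution S (\<lambda>s. P (a *\<^sub>R u s + b *\<^sub>R v s)) t" if "0 \<le> t" for t
  proof -
    have "u t = S t x + convolution S (\<lambda>s. P (u s)) t" "v t = S t y + convolution S (\<lambda>s. P (v s)) t"
      using u v that by (auto simp: mild_solution_def)
    moreover have "convolution S (\<lambda>s. P (a *\<^sub>R u s + b *\<^sub>R v s)) t
        = a *\<^sub>R convolution S (\<lambda>s. P (u s)) t + b *\<^sub>R convolution S (\<lambda>s. P (v s)) t"
      using convolution_linear[OF S continuous_perturbation[OF cu] continuous_perturbation[OF cv]]
      by (simp add: blinfun.add_right blinfun.scaleR_right)
    ultimately show ?thesis
      by (simp add: blinfun.add_right blinfun.scaleR_right scaleR_add_right)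
  qed
  ultimately show ?thesis by (auto simp: mild_solution_def)
qed

text \<open>The difference of the two solutions is a mild solution with initial vector 0, so the
  bound forces it to vanish.\<close>

lemma mild_solution_unique:
  assumes "mild_solution S P x u" "mild_solution S P x v" "0 \<le> t"
  shows "u t = v t"
  using mild_solution_bound[OF mild_solution_linear[OF assms(1,2), of 1 "-1"] assms(3)] by simp

lemma mild_solution_shift:
  assumes u: "mild_solution S P x u" and s: "0 \<le> s"
  shows "mild_solution S P (u s) (\<lambda>t. u (s + t))"
proof -
  have cu: "continuous_on {0..} u" using u by (simp add: mild_solution_def)
  have eq: "u t = S t x + convolution S (\<lambda>s. P (u s)) t" if "0 \<le> t" for t
    using u that by (simp add: mild_solution_def)
  have "continuous_on {0..} (\<lambda>t. u (s + t))"
    using s by (intro continuous_on_compose2[OF cu] continuous_intros) auto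
  moreover have "bounded ((\<lambda>t. u (s + t)) ` {0..})"
    using u s by (auto simp: mild_solution_def intro: bounded_subset)
  moreover have "u (s + t) = S t (u s) + convolution S (\<lambda>r. P (u (s + r))) t" if t: "0 \<le> t" for t
  proof -
    have "S (s + t) = S t o\<^sub>L S s"
      using C0_semigroup_add[OF S t s] by (simp add: add.commute)
    then show ?thesis
      using eq[of "s + t"] eq[OF s] convolution_add[OF S continuous_perturbation[OF cu] s t] s t
      by (simp add: blinfun.add_right)
  qed
  ultimately show ?thesis by (auto simp: mild_solution_def)
qed

text \<open>The semigroup law is uniqueness: the shifted solution and the solution restarted at
  \<open>U x t\<close> share their initial vector. Since \<open>V h x - S h x\<close> is a Duhamel
  integral, its slope at 0 exists for every \<open>x\<close>, which later forces the two generators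
  to have the same domain.\<close>

lemma perturbed_semigroup_exists:
  "\<exists>V. C0_semigroup V \<and> (\<forall>x. ((\<lambda>h. (1 / h) *\<^sub>R (V h x - S h x)) \<longlongrightarrow> P x) (at_right 0))"
proof -
  obtain U where U: "\<And>x. mild_solution S P x (U x)"
    using mild_solution_exists by metis
  \<comment> \<open>For negative \<open>t\<close> the map need not be linear and \<open>V t\<close>
    has no meaning; only nonnegative times are used below.\<close>
  define V where "V t = Blinfun (\<lambda>x. U x t)" for t
  have V: "V t x = U x t" if t: "0 \<le> t" for t x
  proof -
    have lin: "U (a *\<^sub>R x + b *\<^sub>R y) t = a *\<^sub>R U x t + b *\<^sub>R U y t" for a b x y
      using mild_solution_unique[OF U mild_solution_linear[OF U U] t] by simp
    have "bounded_linear (\<lambda>x. U x t)"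
    proof (rule bounded_linear_intro)
      show "U (x + y) t = U x t + U y t" for x y using lin[of 1 x 1 y] by simp
      show "U (r *\<^sub>R x) t = r *\<^sub>R U x t" for r x using lin[of r x 0 0] by simp
      show "norm (U x t) \<le> norm x * (2 * M)" for x
        using mild_solution_bound[OF U t, of x] by (simp add: mult_ac)
    qed
    then show ?thesis
      by (simp add: V_def bounded_linear_Blinfun_apply)
  qed
  have U0: "U x 0 = x" for x
    using U[of x] by (simp add: mild_solution_def convolution_def C0_semigroup_0[OF S])
  have cU: "continuous_on {0..} (U x)" for x
    using U[of x] by (simp add: mild_solution_def)
  have "C0_semigroup V"
    unfolding C0_semigroup_def
  proof (intro conjI allI impI)
    show "V 0 = id_blinfun"
      by (rule blinfun_eqI) (simp add: V U0)
    show "V (s + t) = V s o\<^sub>L V t" if "0 \<le> s" "0 \<le> t" for s t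
    proof (rule blinfun_eqI)
      fix x
      show "V (s + t) x = (V s o\<^sub>L V t) x"
        using mild_solution_unique[OF mild_solution_shift[OF U \<open>0 \<le> t\<close>] U \<open>0 \<le> s\<close>] that
        by (simp add: V add.commute)
    qed
    fix x
    have "(U x \<longlongrightarrow> U x 0) (at 0 within {0..})"
      using cU[of x] unfolding continuous_on_def by (rule bspec) simp
    then have "(U x \<longlongrightarrow> x) (at_right 0)"
      by (simp only: at_within_Ici_at_right U0)
    then show "((\<lambda>t. V t x) \<longlongrightarrow> x) (at_right 0)"
      by (rule Lim_transform_eventually) (auto intro!: eventually_at_rightI[of 0 1] simp: V)
  qed
  moreover have "((\<lambda>h. (1 / h) *\<^sub>R (V h x - S h x)) \<longlongrightarrow> P x) (at_right 0)" for x
  proof -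
    have eq: "V h x - S h x = convolution S (\<lambda>s. P (U x s)) h" if "0 \<le> h" for h
      using U[of x] V[OF that, of x] that by (simp add: mild_solution_def)
    have "((\<lambda>h. (1 / h) *\<^sub>R convolution S (\<lambda>s. P (U x s)) h) \<longlongrightarrow> P (U x 0)) (at_right 0)"
      by (rule convolution_slope_0[OF S continuous_perturbation[OF cU]])
    moreover have "\<forall>\<^sub>F h in at_right 0. (1 / h) *\<^sub>R convolution S (\<lambda>s. P (U x s)) h
        = (1 / h) *\<^sub>R (V h x - S h x)"
      by (rule eventually_at_rightI[of 0 1]) (simp_all add: eq)
    ultimately show ?thesis
      unfolding U0 by (rule Lim_transform_eventually)
  qed
  ultimately show ?thesis by blast
qed

end

section \<open>Generators and quantitative bounds under perturbation\<close>

lemma generator_value_perturbed_iff: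
  fixes S V :: "real \<Rightarrow> 'a::real_normed_vector \<Rightarrow>\<^sub>L 'a"
  assumes "((\<lambda>h. (1 / h) *\<^sub>R (V h x - S h x)) \<longlongrightarrow> p) (at_right 0)"
  shows "has_generator_value V x (y + p) \<longleftrightarrow> has_generator_value S x y"
proof
  assume "has_generator_value S x y"
  from tendsto_add[OF this[unfolded has_generator_value_def] assms]
  show "has_generator_value V x (y + p)"
    by (simp add: has_generator_value_def flip: scaleR_add_right)
next
  assume "has_generator_value V x (y + p)"
  from tendsto_diff[OF this[unfolded has_generator_value_def] assms]
  show "has_generator_value S x y"
    by (simp add: has_generator_value_def flip: scaleR_diff_right)
qed

lemma C0_semigroup_power_bound:
  assumes V: "C0_semigroup V" and "0 \<le> T" and q: "norm (V T) \<le> q"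
    and r: "0 \<le> r" "norm (V r) \<le> N"
  shows "norm (V (real n * T + r)) \<le> q ^ n * N"
proof (induction n)
  case (Suc n)
  have q0: "0 \<le> q" using q norm_ge_zero order.trans by blast
  have "V (real (Suc n) * T + r) = V T o\<^sub>L V (real n * T + r)"
    using C0_semigroup_add[OF V, of T "real n * T + r"] \<open>0 \<le> T\<close> r by (simp add: algebra_simps)
  then have "norm (V (real (Suc n) * T + r)) \<le> norm (V T) * norm (V (real n * T + r))"
    by (simp add: norm_blinfun_compose)
  also have "\<dots> \<le> q * (q ^ n * N)"
    using q0 by (intro mult_mono q Suc.IH) auto
  finally show ?case by (simp add: mult_ac)
qed (use r in simp)

lemma perturbed_nilpotent_bounds:
  fixes S V :: "real \<Rightarrow> 'a::banach \<Rightarrow>\<^sub>L 'a" and P :: "'a \<Rightarrow>\<^sub>L 'a"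
  assumes S: "generates_C0_semigroup D A S" and V: "generates_C0_semigroup D (\<lambda>x. A x + P x) V"
    and "0 \<le> T" and M: "\<And>t. 0 \<le> t \<Longrightarrow> t \<le> T \<Longrightarrow> norm (S t) \<le> M"
    and small: "M * norm P * T \<le> 1 / 2"
  shows "\<And>t. 0 \<le> t \<Longrightarrow> t \<le> T \<Longrightarrow> norm (V t) \<le> 2 * M"
    and "norm (V T - S T) \<le> M * norm P * (2 * M) * T"
proof -
  have CS: "C0_semigroup S" and DS: "D = {x. \<exists>y. has_generator_value S x y}"
    and AS: "\<And>x. x \<in> D \<Longrightarrow> has_generator_value S x (A x)"
    using S by (auto simp: generates_C0_semigroup_def)
  have CV: "C0_semigroup V" and DV: "D = {x. \<exists>y. has_generator_value V x y}"
    and AV: "\<And>x. x \<in> D \<Longrightarrow> has_generator_value V x (A x + P x)"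
    using V by (auto simp: generates_C0_semigroup_def)
  have dense: "closure D = UNIV"
    unfolding DS by (rule generator_domain_dense[OF CS])
  have inv: "V s x \<in> D" if "x \<in> D" "0 \<le> s" for x s
    using generator_value_invariant[OF CV that(2) AV[OF that(1)]] unfolding DV by auto
  have diff: "((\<lambda>h. (1 / h) *\<^sub>R (V h x - S h x)) \<longlongrightarrow> P x) (at_right 0)" if "x \<in> D" for x
    using tendsto_diff[OF AV[OF that, unfolded has_generator_value_def]
        AS[OF that, unfolded has_generator_value_def]]
    by (simp flip: scaleR_diff_right)
  have M0: "0 \<le> M" using M[of 0] \<open>0 \<le> T\<close> norm_ge_zero order.trans by blast
  have *: "norm (V t - S t) \<le> M * norm P * N * t"
    if "0 \<le> t" "t \<le> T" and N: "\<And>s. 0 \<le> s \<Longrightarrow> s \<le> T \<Longrightarrow> norm (V s) \<le> N" for t N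
    using that M by (intro semigroup_difference_bound[OF CS CV dense inv diff]) auto
  let ?N = "SUP s\<in>{0..T}. norm (V s)"
  obtain N where "\<And>s. 0 \<le> s \<Longrightarrow> s \<le> T \<Longrightarrow> norm (V s) \<le> N"
    using C0_semigroup_locally_bounded[OF CV] by blast
  then have bdd: "bdd_above ((\<lambda>s. norm (V s)) ` {0..T})"
    by (intro bdd_aboveI[of _ N]) auto
  have N: "norm (V s) \<le> ?N" if "0 \<le> s" "s \<le> T" for s
    using that by (intro cSUP_upper bdd) auto
  have N0: "0 \<le> ?N"
    using N[of 0] \<open>0 \<le> T\<close> norm_ge_zero order.trans by blast
  have "?N \<le> M + ?N / 2"
  proof (rule cSUP_least)
    fix t assume t: "t \<in> {0..T}"
    have "norm (V t) \<le> norm (S t) + norm (V t - S t)"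
      using norm_triangle_ineq[of "S t" "V t - S t"] by simp
    also have "\<dots> \<le> M + M * norm P * ?N * t"
      using t M *[OF _ _ N] by (intro add_mono) auto
    also have "M * norm P * ?N * t \<le> M * norm P * ?N * T"
      using t M0 N0 by (intro mult_left_mono) auto
    also have "\<dots> = (M * norm P * T) * ?N" by simp
    also have "\<dots> \<le> 1 / 2 * ?N"
      using small N0 by (rule mult_right_mono)
    finally show "norm (V t) \<le> M + ?N / 2" by simp
  qed (use \<open>0 \<le> T\<close> in auto)
  with N show bound: "norm (V t) \<le> 2 * M" if "0 \<le> t" "t \<le> T" for t
    using that by (smt (verit) field_sum_of_halves)
  show "norm (V T - S T) \<le> M * norm P * (2 * M) * T"
    using \<open>0 \<le> T\<close> by (intro * bound) auto
qed

text \<open>Replacing the bound \<open>\<epsilon> * q\<close> for \<open>norm (V T)\<close> by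
  \<open>sqrt \<epsilon>\<close> absorbs the constant \<open>q\<close> into the choice of
  \<open>\<epsilon>\<^sub>0\<close>. Each period \<open>T\<close> then contributes half a power of
  \<epsilon>, whence the rate \<open>1 / (2 * T)\<close>.\<close>

lemma perturbation_of_nilpotent_semigroup:
  fixes D :: "'a::banach set" and B :: "'a \<Rightarrow>\<^sub>L 'a" and T :: real
  assumes S: "generates_C0_semigroup D A S" and T: "T > 0" and ST: "S T = 0"
  obtains \<epsilon>\<^sub>0 M C :: real where "\<epsilon>\<^sub>0 > 0" "M > 0" "C > 0"
    "\<And>\<epsilon>. 0 < \<epsilon> \<Longrightarrow> \<epsilon> < \<epsilon>\<^sub>0 \<Longrightarrow> \<exists>V. generates_C0_semigroup D (\<lambda>x. A x + \<epsilon> *\<^sub>R B x) V"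
    "\<And>\<epsilon> V t. 0 < \<epsilon> \<Longrightarrow> \<epsilon> < \<epsilon>\<^sub>0 \<Longrightarrow> generates_C0_semigroup D (\<lambda>x. A x + \<epsilon> *\<^sub>R B x) V \<Longrightarrow> 0 \<le> t \<Longrightarrow>
      norm (V t) \<le> M * min 1 (exp (- (C * ln (inverse \<epsilon>)) * t) / \<epsilon>)"
proof -
  have CS: "C0_semigroup S" and DS: "D = {x. \<exists>y. has_generator_value S x y}"
    and AS: "\<And>x. x \<in> D \<Longrightarrow> has_generator_value S x (A x)"
    using S by (auto simp: generates_C0_semigroup_def)
  obtain M where M1: "M \<ge> 1" and MT: "\<And>t. 0 \<le> t \<Longrightarrow> t \<le> T \<Longrightarrow> norm (S t) \<le> M"
    using C0_semigroup_locally_bounded[OF CS] by blast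
  have nil: "S t = 0" if "T \<le> t" for t
    using C0_semigroup_add[OF CS, of "t - T" T] ST T that by (auto intro: blinfun_eqI)
  have M: "norm (S t) \<le> M" if "0 \<le> t" for t
    using MT[OF that] nil[of t] M1 by (cases "t \<le> T") auto
  \<comment> \<open>The summand 1 keeps \<open>q\<close> positive even if \<open>B = 0\<close>. The
    condition \<open>\<epsilon> < 1 / q\<^sup>2\<close> yields
    \<open>\<epsilon> * q \<le> sqrt \<epsilon>\<close>, and \<open>\<epsilon> < 1\<close> makes
    \<open>ln \<epsilon>\<close> negative.\<close>
  define q where "q = 2 * M * M * (norm B + 1) * T"
  define \<epsilon>\<^sub>0 where "\<epsilon>\<^sub>0 = min 1 (1 / q\<^sup>2)"
  have q: "q > 0" using M1 T by (auto simp: q_def intro!: mult_pos_pos add_nonneg_pos)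
  then have "\<epsilon>\<^sub>0 > 0" by (simp add: \<epsilon>\<^sub>0_def)
  have sqrt: "\<epsilon> * q \<le> sqrt \<epsilon>" and le1: "\<epsilon> < 1" if "0 < \<epsilon>" "\<epsilon> < \<epsilon>\<^sub>0" for \<epsilon>
  proof -
    show "\<epsilon> < 1" using that by (simp add: \<epsilon>\<^sub>0_def)
    have "\<epsilon> * q\<^sup>2 \<le> 1"
      using that q by (simp add: \<epsilon>\<^sub>0_def pos_less_divide_eq)
    then have "\<epsilon> * (\<epsilon> * q\<^sup>2) \<le> \<epsilon> * 1"
      using that by (intro mult_left_mono) auto
    then show "\<epsilon> * q \<le> sqrt \<epsilon>"
      by (intro real_le_rsqrt) (simp add: power2_eq_square mult_ac)
  qed
  have small: "M * norm (\<epsilon> *\<^sub>R B) * T \<le> 1 / 2" and qT: "M * norm (\<epsilon> *\<^sub>R B) * (2 * M) * T \<le> \<epsilon> * q"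
    if "0 < \<epsilon>" "\<epsilon> < \<epsilon>\<^sub>0" for \<epsilon>
  proof -
    have le: "M * norm (\<epsilon> *\<^sub>R B) * T * (2 * M) \<le> \<epsilon> * q"
      using that M1 T by (simp add: q_def algebra_simps)
    then show "M * norm (\<epsilon> *\<^sub>R B) * (2 * M) * T \<le> \<epsilon> * q" by (simp add: mult_ac)
    \<comment> \<open>Smallness follows from the estimate \<open>le\<close>, because
      \<open>M \<ge> 1\<close> and
      \<open>\<epsilon> * q \<le> sqrt \<epsilon> \<le> 1\<close>.\<close>
    have "M * norm (\<epsilon> *\<^sub>R B) * T * 2 \<le> M * norm (\<epsilon> *\<^sub>R B) * T * (2 * M)"
      using M1 T by (intro mult_left_mono) auto
    also note le
    also have "\<epsilon> * q \<le> 1"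
      using sqrt[OF that] le1[OF that] that(1) by (smt (verit) real_sqrt_le_1_iff)
    finally show "M * norm (\<epsilon> *\<^sub>R B) * T \<le> 1 / 2" by simp
  qed
  show thesis
  proof (rule that[of \<epsilon>\<^sub>0 "2 * M" "1 / (2 * T)"])
    show "\<epsilon>\<^sub>0 > 0" "2 * M > 0" "1 / (2 * T) > 0" using \<open>\<epsilon>\<^sub>0 > 0\<close> M1 T by auto
  next
    fix \<epsilon> assume e: "0 < \<epsilon>" "\<epsilon> < \<epsilon>\<^sub>0"
    interpret small_perturbation S "\<epsilon> *\<^sub>R B" T M
      using CS T nil M small[OF e] by unfold_locales auto
    obtain V where V: "C0_semigroup V"
      and diff: "\<And>x. ((\<lambda>h. (1 / h) *\<^sub>R (V h x - S h x)) \<longlongrightarrow> \<epsilon> *\<^sub>R B x) (at_right 0)"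
      using perturbed_semigroup_exists by (auto simp: blinfun.scaleR_left)
    have iff: "has_generator_value V x (y + \<epsilon> *\<^sub>R B x) \<longleftrightarrow> has_generator_value S x y" for x y
      by (rule generator_value_perturbed_iff[OF diff])
    \<comment> \<open>For the inclusion from right to left, a value \<open>z\<close> for
      \<open>V\<close> is written as
      \<open>(z - \<epsilon> *\<^sub>R B x) + \<epsilon> *\<^sub>R B x\<close>.\<close>
    have "D = {x. \<exists>y. has_generator_value V x y}"
      unfolding DS using iff by (metis diff_add_cancel)
    then show "\<exists>V. generates_C0_semigroup D (\<lambda>x. A x + \<epsilon> *\<^sub>R B x) V"
      using V AS iff by (auto simp: generates_C0_semigroup_def)
  next
    fix \<epsilon> V and t :: real
    assume e: "0 < \<epsilon>" "\<epsilon> < \<epsilon>\<^sub>0" and t: "0 \<le> t"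
      and V: "generates_C0_semigroup D (\<lambda>x. A x + \<epsilon> *\<^sub>R B x) V"
    have V': "generates_C0_semigroup D (\<lambda>x. A x + (\<epsilon> *\<^sub>R B) x) V"
      using V by (simp add: blinfun.scaleR_left)
    have CV: "C0_semigroup V"
      using V by (simp add: generates_C0_semigroup_def)
    have V2: "norm (V s) \<le> 2 * M" if "0 \<le> s" "s \<le> T" for s
      by (rule perturbed_nilpotent_bounds(1)[OF S V' less_imp_le[OF T] MT small[OF e] that])
    have "norm (V T) \<le> M * norm (\<epsilon> *\<^sub>R B) * (2 * M) * T"
      using perturbed_nilpotent_bounds(2)[OF S V' less_imp_le[OF T] MT small[OF e]] by (simp add: ST)
    then have VT: "norm (V T) \<le> sqrt \<epsilon>"
      using qT[OF e] sqrt[OF e] by linarith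
    define n where "n = nat \<lfloor>t / T\<rfloor>"
    define r where "r = t - real n * T"
    have n: "real n \<le> t / T" "t / T < real n + 1"
      using t T by (auto simp: n_def)
    then have r: "0 \<le> r" "r \<le> T"
      using T by (auto simp: r_def field_simps)
    have bound: "norm (V t) \<le> sqrt \<epsilon> ^ n * (2 * M)"
      using C0_semigroup_power_bound[OF CV less_imp_le[OF T] VT r(1) V2[OF r], of n]
      by (simp add: r_def)
    have "sqrt \<epsilon> ^ n \<le> 1"
      using e le1[OF e] by (intro power_le_one) auto
    moreover have "sqrt \<epsilon> ^ n \<le> exp (- (1 / (2 * T) * ln (inverse \<epsilon>)) * t) / \<epsilon>"
    proof -
      have L: "ln \<epsilon> < 0" using e le1[OF e] by simp
      have "sqrt \<epsilon> = exp (ln \<epsilon> / 2)"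
        by (rule real_sqrt_unique) (use e in \<open>simp_all flip: exp_double\<close>)
      then have "sqrt \<epsilon> ^ n = exp (real n * (ln \<epsilon> / 2))"
        by (simp only: exp_of_nat_mult)
      \<comment> \<open>\<open>n \<ge> t / T - 1\<close> holds, but \<open>- 2\<close> gives exactly the prefactor \<open>1 / \<epsilon>\<close>.\<close>
      also have "real n * (ln \<epsilon> / 2) \<le> (t / T - 2) * (ln \<epsilon> / 2)"
        using n L by (intro mult_right_mono_neg) auto
      also have "(t / T - 2) * (ln \<epsilon> / 2) = - (1 / (2 * T) * ln (inverse \<epsilon>)) * t - ln \<epsilon>"
        unfolding ln_inverse using T by (simp add: field_simps)
      finally show ?thesis
        using e by (simp add: exp_diff)
    qed
    ultimately have "sqrt \<epsilon> ^ n \<le> min 1 (exp (- (1 / (2 * T) * ln (inverse \<epsilon>)) * t) / \<epsilon>)"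
      by simp
    then have "sqrt \<epsilon> ^ n * (2 * M) \<le> min 1 (exp (- (1 / (2 * T) * ln (inverse \<epsilon>)) * t) / \<epsilon>) * (2 * M)"
      using M1 by (intro mult_right_mono) auto
    with bound show "norm (V t) \<le> 2 * M * min 1 (exp (- (1 / (2 * T) * ln (inverse \<epsilon>)) * t) / \<epsilon>)"
      by (simp only: mult.commute[of "2 * M"])
  qed
qed

subsection \<open>Transfer to complete inner product spaces\<close>

text \<open>
  The sort \<open>{real_inner, complete_space}\<close> is not below the class \<open>banach\<close>, which the integral requires.
  An isometric copy of the space is therefore declared a Banach space.
\<close>

typedef ('a :: "{real_normed_vector, complete_space}") banach_copy = "UNIV :: 'a set"
  morphisms of_copy to_copy
  by simp

lemmas copy_simps [simp] = of_copy_inverse to_copy_inverse[OF UNIV_I] of_copy_inject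

instantiation banach_copy :: ("{real_normed_vector, complete_space}") real_normed_vector
begin

definition "0 = to_copy 0"
definition "x + y = to_copy (of_copy x + of_copy y)"
definition "x - y = to_copy (of_copy x - of_copy y)"
definition "- x = to_copy (- of_copy x)"
definition "c *\<^sub>R x = to_copy (c *\<^sub>R of_copy x)"
definition "norm x = norm (of_copy x)"
definition "dist x y = norm (of_copy x - of_copy y)"
definition "sgn x = to_copy (sgn (of_copy x))"
definition "uniformity = (INF e\<in>{0<..}. principal {(x :: 'a banach_copy, y). dist x y < e})"
definition "open (U :: 'a banach_copy set) \<longleftrightarrow>
  (\<forall>x\<in>U. eventually (\<lambda>(x', y). x' = x \<longrightarrow> y \<in> U) uniformity)"

lemma of_copy_simps [simp]:
  "of_copy 0 = 0" "of_copy (x + y) = of_copy x + of_copy y" "of_copy (x - y) = of_copy x - of_copy y"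
  "of_copy (- x) = - of_copy x" "of_copy (c *\<^sub>R x) = c *\<^sub>R of_copy x"
  by (simp_all add: zero_banach_copy_def plus_banach_copy_def minus_banach_copy_def
      uminus_banach_copy_def scaleR_banach_copy_def)

instance
proof
  fix x y z :: "'a banach_copy" and a b :: real
  show "norm (x + y) \<le> norm x + norm y"
    by (simp add: norm_banach_copy_def norm_triangle_ineq)
  show "sgn x = inverse (norm x) *\<^sub>R x"
    by (simp add: sgn_banach_copy_def norm_banach_copy_def sgn_div_norm scaleR_banach_copy_def)
qed (simp_all add: norm_banach_copy_def dist_banach_copy_def uniformity_banach_copy_def
    open_banach_copy_def algebra_simps flip: of_copy_inject)

end

instance banach_copy :: ("{real_normed_vector, complete_space}") banach
proof
  fix X :: "nat \<Rightarrow> 'a banach_copy"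
  have dist: "dist x y = dist (of_copy x) (of_copy y)" for x y :: "'a banach_copy"
    by (simp add: dist_banach_copy_def dist_norm)
  assume "Cauchy X"
  then have "Cauchy (\<lambda>n. of_copy (X n))"
    by (simp add: Cauchy_def dist)
  then obtain l where "(\<lambda>n. of_copy (X n)) \<longlonglongrightarrow> l"
    using Cauchy_convergent convergent_def by blast
  then have "X \<longlonglongrightarrow> to_copy l"
    by (simp add: tendsto_iff dist)
  then show "convergent X"
    by (rule convergentI)
qed

text \<open>Conjugation by a surjective linear isometry preserves operator norms, strongly
  continuous semigroups and generators. Keeping the inverse as a second bounded operator makes the
  situation symmetric, so results can be carried in both directions.\<close>

locale linear_isometry_pair =
  fixes f :: "'a::real_normed_vector \<Rightarrow>\<^sub>L 'b::real_normed_vector" and g :: "'b \<Rightarrow>\<^sub>L 'a"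
  assumes gf: "g (f x) = x" and fg: "f (g y) = y" and norm_f: "norm (f x) = norm x"
begin

definition conjugate :: "('a \<Rightarrow>\<^sub>L 'a) \<Rightarrow> 'b \<Rightarrow>\<^sub>L 'b" where
  "conjugate F = f o\<^sub>L F o\<^sub>L g"

lemma conjugate_apply: "conjugate F y = f (F (g y))"
  by (simp add: conjugate_def)

lemma norm_g: "norm (g y) = norm y"
  using norm_f[of "g y"] by (simp add: fg)

lemma norm_conjugate: "norm (conjugate F) = norm F"
proof (rule antisym)
  show "norm (conjugate F) \<le> norm F"
    by (rule norm_blinfun_bound) (use norm_blinfun[of F "g _"] in \<open>auto simp: conjugate_apply norm_f norm_g\<close>)
  have "norm (F x) \<le> norm (conjugate F) * norm x" for x
    using norm_blinfun[of "conjugate F" "f x"] by (simp add: conjugate_apply norm_f gf)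
  then show "norm F \<le> norm (conjugate F)"
    by (intro norm_blinfun_bound) auto
qed

lemma C0_semigroup_conjugate:
  assumes S: "C0_semigroup S"
  shows "C0_semigroup (\<lambda>t. conjugate (S t))"
  unfolding C0_semigroup_def
proof (intro conjI allI impI)
  show "conjugate (S 0) = id_blinfun"
    by (rule blinfun_eqI) (simp add: conjugate_apply C0_semigroup_0[OF S] fg)
  show "conjugate (S (s + t)) = conjugate (S s) o\<^sub>L conjugate (S t)" if "0 \<le> s" "0 \<le> t" for s t
    by (rule blinfun_eqI) (simp add: conjugate_apply C0_semigroup_add[OF S that] gf)
  have "((\<lambda>t. f (S t (g y))) \<longlongrightarrow> f (g y)) (at_right 0)" for y
    by (intro tendsto_intros C0_semigroup_tendsto[OF S])
  then show "((\<lambda>t. conjugate (S t) y) \<longlongrightarrow> y) (at_right 0)" for y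
    by (simp add: conjugate_apply fg)
qed

lemma generator_value_conjugate:
  "has_generator_value (\<lambda>t. conjugate (S t)) x y \<longleftrightarrow> has_generator_value S (g x) (g y)"
proof
  assume "has_generator_value (\<lambda>t. conjugate (S t)) x y"
  then have "((\<lambda>h. g ((1 / h) *\<^sub>R (conjugate (S h) x - x))) \<longlongrightarrow> g y) (at_right 0)"
    unfolding has_generator_value_def by (intro tendsto_intros)
  then show "has_generator_value S (g x) (g y)"
    by (simp add: has_generator_value_def conjugate_apply blinfun.scaleR_right blinfun.diff_right gf)
next
  assume "has_generator_value S (g x) (g y)"
  then have "((\<lambda>h. f ((1 / h) *\<^sub>R (S h (g x) - g x))) \<longlongrightarrow> f (g y)) (at_right 0)"
    unfolding has_generator_value_def by (intro tendsto_intros)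
  then show "has_generator_value (\<lambda>t. conjugate (S t)) x y"
    by (simp add: has_generator_value_def conjugate_apply blinfun.scaleR_right blinfun.diff_right fg)
qed

lemma generates_conjugate:
  assumes "generates_C0_semigroup D A S"
  shows "generates_C0_semigroup (f ` D) (\<lambda>x. f (A (g x))) (\<lambda>t. conjugate (S t))"
proof -
  have D: "D = {x. \<exists>y. has_generator_value S x y}"
    using assms by (simp add: generates_C0_semigroup_def)
  have "f ` D = {x. g x \<in> D}"
    by (auto simp: gf) (metis fg image_eqI)
  also have "\<dots> = {x. \<exists>y. has_generator_value (\<lambda>t. conjugate (S t)) x y}"
    unfolding D generator_value_conjugate by (auto simp: gf) (metis gf)
  finally show ?thesis
    using assms by (auto simp: generates_C0_semigroup_def C0_semigroup_conjugate generator_value_conjugate gf)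
qed

end

theorem theorem1:
  fixes D :: "'a::{real_inner, complete_space} set"
    and A :: "'a \<Rightarrow> 'a"
    and B :: "'a \<Rightarrow>\<^sub>L 'a"
    and S :: "real \<Rightarrow> 'a \<Rightarrow>\<^sub>L 'a"
    and T :: real
  assumes "generates_C0_semigroup D A S"
    and "T > 0"
    and "S T = 0"
  shows "\<exists>\<epsilon>\<^sub>0 M C :: real. \<epsilon>\<^sub>0 > 0 \<and> M > 0 \<and> C > 0 \<and>
    (\<forall>\<epsilon>. 0 < \<epsilon> \<and> \<epsilon> < \<epsilon>\<^sub>0 \<longrightarrow>
      (\<exists>S\<^sub>\<epsilon>. generates_C0_semigroup D (\<lambda>x. A x + \<epsilon> *\<^sub>R blinfun_apply B x) S\<^sub>\<epsilon>) \<and>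
      (\<forall>S\<^sub>\<epsilon>. generates_C0_semigroup D (\<lambda>x. A x + \<epsilon> *\<^sub>R blinfun_apply B x) S\<^sub>\<epsilon> \<longrightarrow>
        (\<forall>t\<ge>0. norm (S\<^sub>\<epsilon> t) \<le> M * min 1 (exp (- (C * ln (inverse \<epsilon>)) * t) / \<epsilon>))))"
proof -
  define f :: "'a \<Rightarrow>\<^sub>L 'a banach_copy" where "f = Blinfun to_copy"
  define g :: "'a banach_copy \<Rightarrow>\<^sub>L 'a" where "g = Blinfun of_copy"
  have "bounded_linear (to_copy :: 'a \<Rightarrow> 'a banach_copy)"
    by (rule bounded_linear_intro[where K = 1])
       (simp_all add: norm_banach_copy_def flip: of_copy_inject)
  then have f: "f x = to_copy x" for x
    by (simp add: f_def bounded_linear_Blinfun_apply)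
  have "bounded_linear (of_copy :: 'a banach_copy \<Rightarrow> 'a)"
    by (rule bounded_linear_intro[where K = 1]) (simp_all add: norm_banach_copy_def)
  then have g: "g x = of_copy x" for x
    by (simp add: g_def bounded_linear_Blinfun_apply)
  \<comment> \<open>The direction \<open>fwd\<close> carries the data, and any given perturbed
    semigroup, to the Banach copy, where the bound applies; \<open>bwd\<close> brings the semigroup
    constructed there back to the original space.\<close>
  interpret fwd: linear_isometry_pair f g
    by unfold_locales (simp_all add: f g norm_banach_copy_def)
  interpret bwd: linear_isometry_pair g f
    by unfold_locales (simp_all add: f g norm_banach_copy_def)
  let ?S = "\<lambda>t. fwd.conjugate (S t)" and ?B = "fwd.conjugate B"
  have "?S T = 0"
    by (rule blinfun_eqI) (simp add: fwd.conjugate_apply assms(3))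
  obtain \<epsilon>\<^sub>0 M C :: real where pos: "\<epsilon>\<^sub>0 > 0" "M > 0" "C > 0"
    and ex: "\<And>\<epsilon>. 0 < \<epsilon> \<Longrightarrow> \<epsilon> < \<epsilon>\<^sub>0 \<Longrightarrow>
      \<exists>V. generates_C0_semigroup (f ` D) (\<lambda>x. f (A (g x)) + \<epsilon> *\<^sub>R ?B x) V"
    and bound: "\<And>\<epsilon> V t. 0 < \<epsilon> \<Longrightarrow> \<epsilon> < \<epsilon>\<^sub>0 \<Longrightarrow>
      generates_C0_semigroup (f ` D) (\<lambda>x. f (A (g x)) + \<epsilon> *\<^sub>R ?B x) V \<Longrightarrow> 0 \<le> t \<Longrightarrow>
      norm (V t) \<le> M * min 1 (exp (- (C * ln (inverse \<epsilon>)) * t) / \<epsilon>)"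
    using perturbation_of_nilpotent_semigroup[OF fwd.generates_conjugate[OF assms(1)] assms(2) \<open>?S T = 0\<close>, of ?B]
    by blast
  have "\<exists>V. generates_C0_semigroup D (\<lambda>x. A x + \<epsilon> *\<^sub>R B x) V" if e: "0 < \<epsilon>" "\<epsilon> < \<epsilon>\<^sub>0" for \<epsilon>
  proof -
    obtain V where "generates_C0_semigroup (f ` D) (\<lambda>x. f (A (g x)) + \<epsilon> *\<^sub>R ?B x) V"
      using ex[OF e] by blast
    from bwd.generates_conjugate[OF this]
    have "generates_C0_semigroup D (\<lambda>x. A x + \<epsilon> *\<^sub>R B x) (\<lambda>t. bwd.conjugate (V t))"
      by (simp add: image_image fwd.conjugate_apply fwd.gf blinfun.add_right blinfun.scaleR_right)
    then show ?thesis by blast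
  qed
  moreover have "norm (V t) \<le> M * min 1 (exp (- (C * ln (inverse \<epsilon>)) * t) / \<epsilon>)"
    if e: "0 < \<epsilon>" "\<epsilon> < \<epsilon>\<^sub>0" and V: "generates_C0_semigroup D (\<lambda>x. A x + \<epsilon> *\<^sub>R B x) V" and t: "0 \<le> t"
    for \<epsilon> V t
  proof -
    have "generates_C0_semigroup (f ` D) (\<lambda>x. f (A (g x)) + \<epsilon> *\<^sub>R ?B x) (\<lambda>t. fwd.conjugate (V t))"
      using fwd.generates_conjugate[OF V]
      by (simp add: fwd.conjugate_apply blinfun.add_right blinfun.scaleR_right)
    from bound[OF e this t] show ?thesis by (simp add: fwd.norm_conjugate)
  qed
  ultimately show ?thesis using pos by blast
qed

end
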